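(* Let $d\ge2$, $k>0$, and let $P_k$ be the Poisson kernel of the unit ball $\mathbb{B}$ for the rank one Dunkl Laplacian in $\mathbb{R}^d$. Put $\Phi(x,y):=|x-y|\vee|x-\sigma y|$. Then, for $x\in\mathbb{B}$ and $y\in\mathbb{S}$, with constants in $\asymp$ depending only on $d$ and $k$: 1. If $d=2$, then $$P_k(x,y)\asymp\frac{1-|x|^2}{\Phi(x,y)^{2k}|x-y|^2}\left[1\vee\log\left(\frac{|x_1y_1|}{|x-\sigma y|^2}\right)\right].$$ 2. If $d\ge3$, then $$P_k(x,y)\asymp\frac{1-|x|^2}{\Phi(x,y)^{2k}|x-y|^2\,(|x-y|\wedge|x-\sigma y|)^{d-2}}.$$
   Context: Rank one setting: $x=(x_1,\dots,x_d)$ are coordinates in an orthonormal basis of $\mathbb{R}^d$ such that the root system is $\{\pm\alpha\}$ with $\alpha=(\sqrt2,0,\dots,0)$, the reflection is $\sigma(x_1,x_2,\dots,x_d)=(-x_1,x_2,\dots,x_d)$, and the multiplicity is a number $k>0$. $\mathbb{B}=\{|x|<1\}$, $\mathbb{S}=\{|x|=1\}$. The Poisson kernel is $$P_k(x,y)=c_k\int_{-1}^1\frac{(1-|x|^2)(1-t)^{k-1}(1+t)^k\,dt}{\bigl(|x|^2+1-2(tx_1y_1+x_2y_2+\dots+x_dy_d)\bigr)^{k+d/2}},\qquad x\in\mathbb{B},\ y\in\mathbb{S},$$ with $c_k=\frac{\Gamma(k+1/2)}{\sqrt\pi\,\Gamma(k)}$. $f\asymp g$ means $C^{-1}g\le f\le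 Cg$ for a constant $C>0$ depending on $d$ and $k$ only. $a\vee b=\max(a,b)$, $a\wedge b=\min(a,b)$, and $\log0=-\infty$. *)

theory Defs
  imports "HOL-Analysis.Analysis"
begin

text \<open>
  The index \<open>i\<close> is the coordinate direction of the root, \<open>\<alpha> = axis i (sqrt 2)\<close>, which is
  usually numbered 1.  The dimension is \<open>d = CARD('n)\<close>.
\<close>

definition root_reflection :: "'n::finite \<Rightarrow> real ^ 'n \<Rightarrow> real ^ 'n"
  where "root_reflection i x = (\<chi> j. if j = i then - (x $ j) else x $ j)"

definition dunkl_const :: "real \<Rightarrow> real"
  where "dunkl_const k = Gamma (k + 1/2) / (sqrt pi * Gamma k)"

text \<open>
  For \<open>k < 1\<close> the integrand is unbounded near \<open>t = 1\<close>, but it is absolutely integrable for all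
  \<open>k > 0\<close>, \<open>norm x < 1\<close> and \<open>norm y = 1\<close>.
\<close>

definition dunkl_poisson_kernel :: "real \<Rightarrow> 'n::finite \<Rightarrow> real ^ 'n \<Rightarrow> real ^ 'n \<Rightarrow> real"
  where "dunkl_poisson_kernel k i x y =
    dunkl_const k *
    integral {-1..1} (\<lambda>t.
      (1 - (norm x)\<^sup>2) * (1 - t) powr (k - 1) * (1 + t) powr k /
      ((norm x)\<^sup>2 + 1 - 2 * (t * (x $ i) * (y $ i) + (\<Sum>j\<in>UNIV - {i}. (x $ j) * (y $ j))))
        powr (k + real CARD('n) / 2))"

definition max_dist :: "'n::finite \<Rightarrow> real ^ 'n \<Rightarrow> real ^ 'n \<Rightarrow> real"
  where "max_dist i x y = max (norm (x - y)) (norm (x - root_reflection i y))"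

definition min_dist :: "'n::finite \<Rightarrow> real ^ 'n \<Rightarrow> real ^ 'n \<Rightarrow> real"
  where "min_dist i x y = min (norm (x - y)) (norm (x - root_reflection i y))"

text \<open>
  The convention \<open>log 0 = -\<infinity>\<close> makes the factor equal to 1 when \<open>x $ i * y $ i = 0\<close>.  The
  library value \<open>ln 0 = 0\<close> gives the same maximum.
\<close>

definition log_factor :: "'n::finite \<Rightarrow> real ^ 'n \<Rightarrow> real ^ 'n \<Rightarrow> real"
  where "log_factor i x y =
    max 1 (ln (\<bar>(x $ i) * (y $ i)\<bar> / (norm (x - root_reflection i y))\<^sup>2))"

definition comparable :: "real \<Rightarrow> real \<Rightarrow> real \<Rightarrow> bool"
  where "comparable C a b \<longleftrightarrow> inverse C * b \<le> a \<and> a \<le> C * b"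

end

theory Submission
  imports Defs
begin

text \<open>
  Write \<open>a = |x - y|\<^sup>2\<close>, \<open>b = |x - \<sigma> y|\<^sup>2\<close> and \<open>h = d / 2\<close>.  The denominator of the Poisson kernel
  contains a function of \<open>t\<close> that is affine, equal to \<open>b\<close> at \<open>t = - 1\<close> and to \<open>a\<close> at \<open>t = 1\<close>.
  With \<open>t = 2 u - 1\<close> and \<open>D = u a + (1 - u) b\<close>, the kernel is therefore a constant times
  \<open>1 - |x|\<^sup>2\<close> times the integral of \<open>u\<^sup>k (1 - u)\<^sup>k\<^sup>-\<^sup>1 D\<^sup>-\<^sup>k\<^sup>-\<^sup>h\<close> over \<open>0 \<le> u \<le> 1\<close>,
  and the theorem is a two-sided estimate of this integral, uniform in \<open>a, b > 0\<close>.

  If \<open>a \<le> b\<close> (\<open>x\<close> and \<open>y\<close> on the same side of the mirror), the main contribution comes from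
  \<open>1 - u\<close> of order \<open>a / b\<close>, and the integral is comparable to \<open>a\<^sup>-\<^sup>h b\<^sup>-\<^sup>k\<close>.
  The upper bound loses only \<open>u\<^sup>k \<le> 1\<close> and \<open>D \<ge> a\<close>, because \<open>(1 - u)\<^sup>k D\<^sup>-\<^sup>k\<close> is an
  antiderivative of a multiple of \<open>(1 - u)\<^sup>k\<^sup>-\<^sup>1 D\<^sup>-\<^sup>k\<^sup>-\<^sup>1\<close>
  (\<open>has_integral_near_kernel\<close>).

  If \<open>b \<le> a\<close>, the denominator is smallest near \<open>u = 0\<close>, where the weight vanishes like \<open>u\<^sup>k\<close>.  Since
  \<open>u \<le> D / a\<close>, the weight cancels \<open>D\<^sup>k\<close> at the price of \<open>a\<^sup>-\<^sup>k\<close>, and what remains is comparable to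
  \<open>a\<^sup>-\<^sup>k\<close> times the integral of \<open>(b + u a)\<^sup>-\<^sup>h\<close>, which gives \<open>a\<^sup>-\<^sup>1 b\<^sup>1\<^sup>-\<^sup>h\<close> if \<open>h > 1\<close> and
  \<open>a\<^sup>-\<^sup>1 ln (1 + a / b)\<close> if \<open>h = 1\<close>; the singular weight at \<open>u = 1\<close> adds a multiple of
  \<open>a\<^sup>-\<^sup>k\<^sup>-\<^sup>h\<close>, which is no larger (\<open>segment_integrand_far_upper\<close>).  For the lower bounds it is enough to integrate over
  \<open>u \<le> b / (2 a)\<close>, and over \<open>b / a \<le> u \<le> 1 / 2\<close> to see the logarithm.

  The logarithmic factor in dimension two is that of the theorem because
  \<open>b - a = 4 x\<^sub>1 y\<^sub>1\<close>; for \<open>a \<le> b\<close> its argument is at most \<open>1 / 4\<close>, so that the factor is \<open>1\<close>.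
\<close>

section \<open>The Poisson integral in one real variable\<close>

definition segment_integrand :: "real \<Rightarrow> real \<Rightarrow> real \<Rightarrow> real \<Rightarrow> real \<Rightarrow> real"
  where "segment_integrand k h a b u =
    u powr k * (1 - u) powr (k - 1) * (u * a + (1 - u) * b) powr - (k + h)"

definition segment_integral :: "real \<Rightarrow> real \<Rightarrow> real \<Rightarrow> real \<Rightarrow> real"
  where "segment_integral k h a b = integral {0..1} (segment_integrand k h a b)"

lemma segment_bounds:
  fixes a b u :: real
  assumes "0 < a" "0 < b" "0 \<le> u" "u \<le> 1"
  shows "min a b \<le> u * a + (1 - u) * b" "0 < u * a + (1 - u) * b"
    "u * a \<le> u * a + (1 - u) * b" "u * a + (1 - u) * b \<le> u * a + b"
    "u * a + (1 - u) * b \<le> a + (1 - u) * b"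
proof -
  have "u * min a b \<le> u * a" "(1 - u) * min a b \<le> (1 - u) * b"
    using assms by (auto intro: mult_left_mono)
  then have "u * min a b + (1 - u) * min a b \<le> u * a + (1 - u) * b" by linarith
  then show 1: "min a b \<le> u * a + (1 - u) * b" by (simp add: algebra_simps)
  show "0 < u * a + (1 - u) * b" using 1 assms by linarith
  show "u * a \<le> u * a + (1 - u) * b" using assms by simp
  show "u * a + (1 - u) * b \<le> u * a + b" using assms by (simp add: algebra_simps)
  show "u * a + (1 - u) * b \<le> a + (1 - u) * b" using assms by (simp add: mult_left_le_one_le)
qed

lemma has_integral_powr_right_endpoint:
  fixes k c :: real
  assumes "0 < k" "c \<le> 1"
  shows "((\<lambda>u. (1 - u) powr (k - 1)) has_integral (1 - c) powr k / k) {c..1}"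
proof -
  have "((\<lambda>u. (1 - u) powr (k - 1)) has_integral
      (- ((1 - 1) powr k / k)) - (- ((1 - c) powr k / k))) {c..1}"
    using assms
    by (intro fundamental_theorem_of_calculus_interior)
       (auto intro!: continuous_intros continuous_on_powr' derivative_eq_intros
             simp: has_real_derivative_iff_has_vector_derivative[symmetric])
  then show ?thesis using assms by simp
qed

lemma segment_integrand_nonneg:
  "0 \<le> segment_integrand k h a b u"
  unfolding segment_integrand_def by simp

text \<open>
  The only singularity is the integrable one at \<open>u = 1\<close>; elsewhere the integrand is bounded, because
  \<open>u a + (1 - u) b\<close> stays above \<open>min a b\<close>.
\<close>
lemma segment_integrand_integrable:
  assumes "0 < k" "0 \<le> h" "0 < a" "0 < b"
  shows "segment_integrand k h a b integrable_on {0..1}"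
proof (rule measurable_bounded_by_integrable_imp_integrable)
  have "segment_integrand k h a b \<in> borel_measurable borel"
    unfolding segment_integrand_def by measurable
  then show "segment_integrand k h a b \<in> borel_measurable (lebesgue_on {0..1})"
    by (simp add: borel_measurable_if_D measurable_completion measurable_restrict_space1)
  show "(\<lambda>u. (1 - u) powr (k - 1) * min a b powr - (k + h)) integrable_on {0..1}"
    using has_integral_mult_left[OF has_integral_powr_right_endpoint[of k 0]] assms
    by (auto simp: integrable_on_def)
  show "norm (segment_integrand k h a b u) \<le> (1 - u) powr (k - 1) * min a b powr - (k + h)"
    if "u \<in> {0..1}" for u
  proof -
    have "(u * a + (1 - u) * b) powr - (k + h) \<le> min a b powr - (k + h)"
      using assms segment_bounds(1)[of a b u] that by (intro powr_mono2') auto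
    moreover have "u powr k \<le> 1" using that assms by (simp add: powr_le1)
    ultimately have "u powr k * (1 - u) powr (k - 1) * (u * a + (1 - u) * b) powr - (k + h)
        \<le> 1 * (1 - u) powr (k - 1) * min a b powr - (k + h)"
      by (intro mult_mono) auto
    then show ?thesis
      using segment_integrand_nonneg[of k h a b u]
      by (simp add: segment_integrand_def)
  qed
qed auto

lemma segment_integral_le:
  assumes "0 < k" "0 \<le> h" "0 < a" "0 < b"
    and "(g has_integral I) {0..1}"
    and "\<And>u. 0 \<le> u \<Longrightarrow> u \<le> 1 \<Longrightarrow> segment_integrand k h a b u \<le> g u"
  shows "segment_integral k h a b \<le> I"
  unfolding segment_integral_def
  using integrable_integral[OF segment_integrand_integrable[OF assms(1-4)]] assms(5,6)
  by (auto intro: has_integral_le)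

lemma segment_integral_ge:
  assumes "0 < k" "0 \<le> h" "0 < a" "0 < b"
    and "(g has_integral I) {c..d}" "0 \<le> c" "d \<le> 1"
    and "\<And>u. c \<le> u \<Longrightarrow> u \<le> d \<Longrightarrow> g u \<le> segment_integrand k h a b u"
  shows "I \<le> segment_integral k h a b"
proof -
  have int: "segment_integrand k h a b integrable_on {0..1}"
    by (rule segment_integrand_integrable[OF assms(1-4)])
  have sub: "segment_integrand k h a b integrable_on {c..d}"
    by (rule integrable_subinterval_real[OF int]) (use assms in auto)
  have "I \<le> integral {c..d} (segment_integrand k h a b)"
    by (rule has_integral_le[OF assms(5) integrable_integral[OF sub]]) (use assms in auto)
  also have "\<dots> \<le> segment_integral k h a b"
    unfolding segment_integral_def
    by (rule integral_subset_le[OF _ sub int]) (use assms segment_integrand_nonneg in auto)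
  finally show ?thesis .
qed

section \<open>The case of nearby points on the same side of the mirror\<close>

lemma powr_minus_eq_mult:
  fixes x k :: real
  assumes "0 < x"
  shows "x powr - k = x powr - (k + 1) * x"
proof -
  have "x powr - k = x powr (- (k + 1) + 1)" by simp
  also have "\<dots> = x powr - (k + 1) * x powr 1" by (rule powr_add)
  finally show ?thesis using assms by simp
qed

text \<open>
  Quotients of two affine functions of \<open>u\<close> have constant numerator in their derivative: with
  \<open>D = u a + (1 - u) b\<close>, the derivative of \<open>(1 - u) / D\<close> is \<open>- a / D\<^sup>2\<close>.  Hence the integrand is the
  derivative of a multiple of \<open>((1 - u) / D)\<^sup>k\<close>.
\<close>
lemma has_integral_near_kernel:
  fixes a b k :: real
  assumes "0 < k" "0 < a" "0 < b"
  shows "((\<lambda>u. (1 - u) powr (k - 1) * (u * a + (1 - u) * b) powr - (k + 1))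
    has_integral b powr - k / (k * a)) {0..1}"
proof -
  let ?D = "\<lambda>u. u * a + (1 - u) * b"
  let ?F = "\<lambda>u. - ((1 - u) powr k * ?D u powr - k / (k * a))"
  have D: "0 < ?D u" if "u \<in> {0..1}" for u
    using segment_bounds(2)[of a b u] assms that by auto
  have "((\<lambda>u. (1 - u) powr (k - 1) * ?D u powr - (k + 1)) has_integral ?F 1 - ?F 0) {0..1}"
  proof (rule fundamental_theorem_of_calculus_interior)
    show "continuous_on {0..1} ?F"
      using assms D less_imp_neq[OF D]
      by (intro continuous_on_minus continuous_on_divide continuous_on_mult
        continuous_on_powr' continuous_intros) (auto simp: less_imp_le)
    fix u :: real assume u: "u \<in> {0<..<1}"
    have Du: "0 < ?D u" using D[of u] u by auto
    have e1: "(1 - u) powr k = (1 - u) powr (k - 1) * (1 - u)"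
      using u by (simp add: powr_diff)
    have e2: "?D u powr - k = ?D u powr - (k + 1) * ?D u"
      by (rule powr_minus_eq_mult[OF Du])
    have d1: "((\<lambda>u. (1 - u) powr k) has_real_derivative k * (1 - u) powr (k - 1) * (- 1)) (at u)"
      using u by (auto intro!: derivative_eq_intros)
    have d0: "(?D has_real_derivative a - b) (at u)"
      by (auto intro!: derivative_eq_intros)
    have d2: "((\<lambda>u. ?D u powr - k) has_real_derivative - k * ?D u powr (- k - 1) * (a - b)) (at u)"
      using DERIV_fun_powr[OF d0 Du, of "- k"] by simp
    have "(?F has_real_derivative
      - ((k * (1 - u) powr (k - 1) * (- 1) * ?D u powr - k
        + (- k * ?D u powr (- k - 1) * (a - b)) * (1 - u) powr k) / (k * a))) (at u)"
      by (intro DERIV_minus DERIV_cdivide DERIV_mult d1 d2)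
    also have "- ((k * (1 - u) powr (k - 1) * (- 1) * ?D u powr - k
        + (- k * ?D u powr (- k - 1) * (a - b)) * (1 - u) powr k) / (k * a))
      = (1 - u) powr (k - 1) * ?D u powr - (k + 1)"
    proof -
      define P where "P = (1 - u) powr (k - 1)"
      define Q where "Q = ?D u powr - (k + 1)"
      have m: "- k - 1 = - (k + 1)" by simp
      show ?thesis unfolding e1 e2 m P_def[symmetric] Q_def[symmetric]
        using assms by (simp add: field_simps)
    qed
    finally show "(?F has_vector_derivative (1 - u) powr (k - 1) * ?D u powr - (k + 1)) (at u)"
      by (simp add: has_real_derivative_iff_has_vector_derivative)
  qed simp
  then show ?thesis using assms by simp
qed

text \<open>
  The excess exponent \<open>h - 1\<close> of the denominator is traded for \<open>a\<^sup>1\<^sup>-\<^sup>h\<close>, which leaves the integrand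
  that has an explicit antiderivative.
\<close>
lemma segment_integral_near_upper:
  assumes "0 < k" "1 \<le> h" "0 < a" "a \<le> b"
  shows "segment_integral k h a b \<le> 1 / k * (a powr - h * b powr - k)"
proof -
  have b: "0 < b" using assms by linarith
  have "segment_integral k h a b \<le> b powr - k / (k * a) * a powr (1 - h)"
  proof (rule segment_integral_le[OF _ _ _ _ has_integral_mult_left[OF has_integral_near_kernel]])
    fix u :: real assume u: "0 \<le> u" "u \<le> 1"
    let ?D = "u * a + (1 - u) * b"
    have D: "a \<le> ?D" using segment_bounds(1)[of a b u] assms b u by simp
    have "?D powr - (k + h) = ?D powr - (k + 1) * ?D powr (1 - h)"
      by (simp add: powr_add[symmetric])
    also have "\<dots> \<le> ?D powr - (k + 1) * a powr (1 - h)"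
      using D assms by (intro mult_left_mono powr_mono2') auto
    finally have *: "?D powr - (k + h) \<le> ?D powr - (k + 1) * a powr (1 - h)" .
    have "u powr k * (1 - u) powr (k - 1) * ?D powr - (k + h)
      \<le> 1 * (1 - u) powr (k - 1) * (?D powr - (k + 1) * a powr (1 - h))"
      using * u assms by (intro mult_mono) (auto simp: powr_le1)
    then show "segment_integrand k h a b u
      \<le> (1 - u) powr (k - 1) * ?D powr - (k + 1) * a powr (1 - h)"
      by (simp add: segment_integrand_def mult.assoc)
  qed (use assms b in auto)
  also have "\<dots> = 1 / k * (a powr - h * b powr - k)"
    using assms by (simp add: powr_diff powr_minus field_simps)
  finally show ?thesis .
qed

text \<open>
  On the layer \<open>1 - u \<le> a / (2 b)\<close> the denominator is at most a power of \<open>2 a\<close> and \<open>u \<ge> 1 / 2\<close>, so only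
  \<open>(1 - u)\<^sup>k\<^sup>-\<^sup>1\<close> is left to integrate.
\<close>
lemma segment_integral_near_lower:
  assumes "0 < k" "1 \<le> h" "0 < a" "a \<le> b"
  shows "2 powr - (3 * k + h) / k * (a powr - h * b powr - k) \<le> segment_integral k h a b"
proof -
  have b: "0 < b" using assms by linarith
  define c where "c = 1 - a / (2 * b)"
  have c: "1/2 \<le> c" "c \<le> 1" using assms b by (auto simp: c_def field_simps)
  have "2 powr - k * (2 * a) powr - (k + h) * ((1 - c) powr k / k) \<le> segment_integral k h a b"
  proof (rule segment_integral_ge[OF _ _ _ _
      has_integral_mult_right[OF has_integral_powr_right_endpoint]])
    fix u assume u: "c \<le> u" "u \<le> 1"
    have u01: "0 \<le> u" using u c by linarith
    let ?D = "u * a + (1 - u) * b"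
    have "(1 - u) * b \<le> (1 - c) * b" using u b by (intro mult_right_mono) auto
    also have "\<dots> = a / 2" using b by (simp add: c_def)
    finally have D: "?D \<le> 2 * a"
      using segment_bounds(5)[of a b u] assms b u u01 by linarith
    have "(1 / 2) powr k \<le> u powr k" using u c assms by (intro powr_mono2) auto
    then have "2 powr - k \<le> u powr k" by (simp add: powr_divide powr_minus field_simps)
    moreover have "(2 * a) powr - (k + h) \<le> ?D powr - (k + h)"
      using D assms b segment_bounds(2)[of a b u] u u01 by (intro powr_mono2') auto
    ultimately have "2 powr - k * (1 - u) powr (k - 1) * (2 * a) powr - (k + h)
      \<le> segment_integrand k h a b u"
      unfolding segment_integrand_def by (intro mult_mono) auto
    then show "2 powr - k * (2 * a) powr - (k + h) * (1 - u) powr (k - 1)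
      \<le> segment_integrand k h a b u"
      by (simp add: mult_ac)
  qed (use assms b c in auto)
  moreover have "2 powr - k * (2 * a) powr - (k + h) * ((1 - c) powr k / k)
      = 2 powr - (3 * k + h) / k * (a powr - h * b powr - k)"
  proof -
    have e: "(1 - c) powr k = a powr k * 2 powr - k * b powr - k"
      using assms b by (simp add: c_def powr_divide powr_mult powr_minus field_simps)
    have e2: "(2 * a) powr - (k + h) = 2 powr - (k + h) * (a powr - k * a powr - h)"
      using assms by (simp add: powr_mult powr_add[symmetric])
    have e3: "2 powr - (3 * k + h) = 2 powr - k * 2 powr - (k + h) * (2 powr - k :: real)"
      by (simp add: powr_add[symmetric])
    have e4: "a powr - k * a powr k = 1"
      using assms by (simp add: powr_add[symmetric])
    have "2 powr - k * (2 * a) powr - (k + h) * ((1 - c) powr k / k)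
      = (2 powr - k * 2 powr - (k + h) * 2 powr - k) / k * (a powr - h * b powr - k)
        * (a powr - k * a powr k)"
      unfolding e e2 by (simp add: mult_ac)
    then show ?thesis unfolding e3 e4 by simp
  qed
  ultimately show ?thesis by (simp only:)
qed

section \<open>The case of points on opposite sides of the mirror\<close>

lemma one_minus_powr_bounds:
  fixes k u :: real
  assumes "0 < k" "0 \<le> u" "u \<le> 1/2"
  shows "2 powr - k \<le> (1 - u) powr (k - 1)" "(1 - u) powr (k - 1) \<le> 2"
proof -
  have half: "(1/2) powr r = 2 powr - r" for r :: real
    by (simp add: powr_divide powr_minus field_simps)
  show "2 powr - k \<le> (1 - u) powr (k - 1)"
  proof (cases "k \<le> 1")
    case True
    have "1 powr (k - 1) \<le> (1 - u) powr (k - 1)"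
      using True assms by (intro powr_mono2') auto
    moreover have "2 powr - k \<le> (2::real) powr 0" using assms by (intro powr_mono) auto
    ultimately show ?thesis by simp
  next
    case False
    have "2 powr - k \<le> (2::real) powr - (k - 1)" by (intro powr_mono) auto
    also have "\<dots> = (1/2) powr (k - 1)" by (simp only: half)
    also have "\<dots> \<le> (1 - u) powr (k - 1)" using False assms by (intro powr_mono2) auto
    finally show ?thesis .
  qed
  show "(1 - u) powr (k - 1) \<le> 2"
  proof (cases "k \<le> 1")
    case True
    have "(1 - u) powr (k - 1) \<le> (1/2) powr (k - 1)"
      using True assms by (intro powr_mono2') auto
    also have "\<dots> = 2 powr - (k - 1)" by (simp only: half)
    also have "\<dots> \<le> (2::real) powr 1" using assms by (intro powr_mono) auto
    finally show ?thesis by simp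
  next
    case False
    have "(1 - u) powr (k - 1) \<le> 1 powr (k - 1)"
      using False assms by (intro powr_mono2) auto
    then show ?thesis by simp
  qed
qed

text \<open>
  For \<open>u \<ge> 1 / 2\<close> the weight is singular but the denominator is not small, and conversely for
  \<open>u \<le> 1 / 2\<close>; the sum of the two bounds serves for all \<open>u\<close>, so that the integral need not be split.
  In the second range \<open>u \<le> D / a\<close> removes the weight \<open>u\<^sup>k\<close>, and \<open>D \<ge> (b + u a) / 2\<close> makes the
  remaining integral explicit, with no denominator \<open>a - b\<close>.
\<close>
lemma segment_integrand_far_upper:
  assumes "0 < k" "1 \<le> h" "0 < b" "b \<le> a" "0 \<le> u" "u \<le> 1"
  shows "segment_integrand k h a b u
    \<le> 2 * 2 powr h * a powr - k * (b + u * a) powr - h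
      + (a / 2) powr - (k + h) * (1 - u) powr (k - 1)"
proof -
  have a: "0 < a" using assms by linarith
  let ?D = "u * a + (1 - u) * b"
  note D = segment_bounds[OF a assms(3,5,6)]
  show ?thesis
  proof (cases "u \<le> 1/2")
    case False
    have "1 / 2 * a \<le> u * a" using False a by (intro mult_right_mono) auto
    then have "a / 2 \<le> ?D" using D by linarith
    then have "?D powr - (k + h) \<le> (a / 2) powr - (k + h)"
      using a assms by (intro powr_mono2') auto
    then have "segment_integrand k h a b u
        \<le> 1 * (1 - u) powr (k - 1) * (a / 2) powr - (k + h)"
      unfolding segment_integrand_def using assms by (intro mult_mono) (auto simp: powr_le1)
    then show ?thesis by (simp add: mult_ac add_increasing)
  next
    case True
    have "u \<le> ?D / a" using D a by (simp add: field_simps)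
    then have "u powr k \<le> (?D / a) powr k" using assms by (intro powr_mono2) auto
    also have "\<dots> = ?D powr k * a powr - k"
      using D a by (simp add: powr_divide powr_minus field_simps)
    finally have u: "u powr k \<le> ?D powr k * a powr - k" .
    have "b \<le> ?D" using D assms by linarith
    then have "b + u * a \<le> 2 * ?D" using add_mono[OF _ D(3)] by (simp only: mult_2)
    then have "(b + u * a) / 2 \<le> ?D" by simp
    then have "?D powr - h \<le> ((b + u * a) / 2) powr - h"
      using assms a by (intro powr_mono2') (auto intro: add_pos_nonneg)
    also have "\<dots> = 2 powr h * (b + u * a) powr - h"
      using assms a by (simp add: powr_divide powr_minus field_simps)
    finally have Dh: "?D powr - h \<le> 2 powr h * (b + u * a) powr - h" .
    have "segment_integrand k h a b u
        \<le> (?D powr k * a powr - k) * 2 * ?D powr - (k + h)"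
      unfolding segment_integrand_def using assms True u one_minus_powr_bounds(2)[of k u]
      by (intro mult_mono) auto
    also have "\<dots> = 2 * a powr - k * (?D powr k * ?D powr - (k + h))"
      by simp
    also have "?D powr k * ?D powr - (k + h) = ?D powr - h"
      by (simp add: powr_add[symmetric])
    also have "2 * a powr - k * ?D powr - h
        \<le> 2 * a powr - k * (2 powr h * (b + u * a) powr - h)"
      using Dh by (intro mult_left_mono) auto
    finally have "segment_integrand k h a b u
        \<le> 2 * 2 powr h * a powr - k * (b + u * a) powr - h" by (simp add: mult_ac)
    then show ?thesis by (simp add: add_increasing2)
  qed
qed

lemma segment_integral_far_le:
  assumes "0 < k" "1 \<le> h" "0 < b" "b \<le> a"
    and "((\<lambda>u. (b + u * a) powr - h) has_integral I) {0..1}"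
  shows "segment_integral k h a b
    \<le> 2 * 2 powr h * a powr - k * I + 2 powr (k + h) / k * a powr - (k + h)"
proof -
  have "segment_integral k h a b
    \<le> 2 * 2 powr h * a powr - k * I + (a / 2) powr - (k + h) * ((1 - 0) powr k / k)"
    by (rule segment_integral_le[OF _ _ _ _ has_integral_add[OF
          has_integral_mult_right[OF assms(5)]
          has_integral_mult_right[OF has_integral_powr_right_endpoint]]])
       (use assms segment_integrand_far_upper in auto)
  also have "(a / 2) powr - (k + h) = 2 powr (k + h) * a powr - (k + h)"
    using assms by (simp add: powr_divide powr_minus_divide del: minus_add_distrib)
  finally show ?thesis by simp
qed

lemma segment_integral_far_upper:
  assumes "0 < k" "1 < h" "0 < b" "b \<le> a"
  shows "segment_integral k h a b
    \<le> (2 * 2 powr h / (h - 1) + 2 powr (k + h) / k) * (a powr - (k + 1) * b powr (1 - h))"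
proof -
  have a: "0 < a" using assms by linarith
  let ?F = "\<lambda>u. - ((b + u * a) powr (1 - h) / ((h - 1) * a))"
  have "((\<lambda>u. (b + u * a) powr - h) has_integral ?F 1 - ?F 0) {0..1}"
  proof (rule fundamental_theorem_of_calculus)
    fix u :: real assume u: "u \<in> {0..1}"
    have pos: "0 < b + u * a" using u assms a by (intro add_pos_nonneg) auto
    have d0: "((\<lambda>u. b + u * a) has_real_derivative a) (at u within {0..1})"
      by (auto intro!: derivative_eq_intros)
    have "((\<lambda>u. (b + u * a) powr (1 - h)) has_real_derivative
        (1 - h) * (b + u * a) powr (1 - h - 1) * a) (at u within {0..1})"
      using pos by (auto intro!: derivative_eq_intros)
    then have "(?F has_real_derivative
        - ((1 - h) * (b + u * a) powr (1 - h - 1) * a / ((h - 1) * a))) (at u within {0..1})"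
      by (intro DERIV_minus DERIV_cdivide)
    also have "- ((1 - h) * (b + u * a) powr (1 - h - 1) * a / ((h - 1) * a))
        = (b + u * a) powr - h"
      using a assms by (simp add: field_simps)
    finally show "(?F has_vector_derivative (b + u * a) powr - h) (at u within {0..1})"
      by (simp add: has_real_derivative_iff_has_vector_derivative)
  qed simp
  from segment_integral_far_le[OF _ _ _ _ this, of k]
  have "segment_integral k h a b \<le> 2 * 2 powr h * a powr - k * (?F 1 - ?F 0)
      + 2 powr (k + h) / k * a powr - (k + h)"
    using assms by simp
  also have "\<dots> \<le> 2 * 2 powr h * a powr - k * (b powr (1 - h) / ((h - 1) * a))
      + 2 powr (k + h) / k * (a powr - (k + 1) * b powr (1 - h))"
  proof (intro add_mono mult_left_mono)
    show "?F 1 - ?F 0 \<le> b powr (1 - h) / ((h - 1) * a)" using assms a by simp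
    have "a powr - (k + h) = a powr - (k + 1) * a powr (1 - h)"
      by (simp add: powr_add[symmetric])
    also have "\<dots> \<le> a powr - (k + 1) * b powr (1 - h)"
      using assms by (intro mult_left_mono powr_mono2') auto
    finally show "a powr - (k + h) \<le> a powr - (k + 1) * b powr (1 - h)" .
  qed (use assms in auto)
  also have "2 * 2 powr h * a powr - k * (b powr (1 - h) / ((h - 1) * a))
      = 2 * 2 powr h / (h - 1) * (a powr - (k + 1) * b powr (1 - h))"
    unfolding powr_minus_eq_mult[OF a, of k] using a assms by (simp add: field_simps)
  finally show ?thesis by (simp add: distrib_right)
qed

text \<open>
  With \<open>m\<close> the maximum on the right, \<open>a / b \<le> 1 + 4 e\<^sup>m\<close>, so that the argument of the logarithm on
  the left is at most \<open>2 + 4 e\<^sup>m\<close>, which is below \<open>e\<^sup>3\<^sup>m\<close> since \<open>m \<ge> 1\<close>.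
\<close>
lemma ln_ratio_le:
  fixes a b :: real
  assumes "0 < b" "b \<le> a"
  shows "ln ((b + a) / b) \<le> 3 * max 1 (ln ((a - b) / 4 / b))"
proof -
  define m where "m = max 1 (ln ((a - b) / 4 / b))"
  have m: "1 \<le> m" by (simp add: m_def)
  have "(a - b) / 4 / b \<le> exp m"
  proof (cases "a = b")
    case False
    then have "(a - b) / 4 / b = exp (ln ((a - b) / 4 / b))"
      using assms by simp
    also have "\<dots> \<le> exp m" by (simp add: m_def)
    finally show ?thesis .
  qed simp
  then have "(b + a) / b \<le> 2 + 4 * exp m" using assms by (simp add: field_simps)
  also have "\<dots> \<le> exp m * exp m * exp m"
  proof -
    \<comment> \<open>The cube absorbs the sum once \<open>exp m \<ge> 5 / 2\<close>; the bound \<open>1 + m \<ge> 2\<close> would be too weak.\<close>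
    have "1 + 1 + 1 / 2 \<le> 1 + m + m\<^sup>2 / 2" using m by (intro add_mono) auto
    then have E: "5 / 2 \<le> exp m" using exp_lower_Taylor_quadratic[of m] m by linarith
    then have "5 / 2 * (5 / 2) \<le> exp m * exp m" by (intro mult_mono) auto
    then have "5 / 2 * (5 / 2) * exp m \<le> exp m * exp m * exp m" by (intro mult_right_mono) auto
    then show ?thesis using E by linarith
  qed
  also have "\<dots> = exp (3 * m)" by (simp add: exp_add[symmetric])
  finally have "ln ((b + a) / b) \<le> ln (exp (3 * m))"
    using assms by (subst ln_le_cancel_iff) auto
  then show ?thesis by (simp add: m_def)
qed

lemma segment_integral_far_upper_log:
  assumes "0 < k" "0 < b" "b \<le> a"
  shows "segment_integral k 1 a b
    \<le> (12 + 2 powr (k + 1) / k) * (a powr - (k + 1) * max 1 (ln ((a - b) / 4 / b)))"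
proof -
  have a: "0 < a" using assms by linarith
  define m where "m = max 1 (ln ((a - b) / 4 / b))"
  let ?F = "\<lambda>u. ln (b + u * a) / a"
  have "((\<lambda>u. (b + u * a) powr - 1) has_integral ?F 1 - ?F 0) {0..1}"
  proof (rule fundamental_theorem_of_calculus)
    fix u :: real assume u: "u \<in> {0..1}"
    have pos: "0 < b + u * a" using u assms a by (intro add_pos_nonneg) auto
    then have "((\<lambda>u. ln (b + u * a)) has_real_derivative (b + u * a) powr - 1 * a)
        (at u within {0..1})"
      by (auto intro!: derivative_eq_intros simp: powr_minus divide_inverse mult.commute)
    from DERIV_cdivide[OF this, of a]
    have "(?F has_real_derivative (b + u * a) powr - 1) (at u within {0..1})"
      using a by simp
    then show "(?F has_vector_derivative (b + u * a) powr - 1) (at u within {0..1})"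
      by (simp add: has_real_derivative_iff_has_vector_derivative)
  qed simp
  from segment_integral_far_le[OF _ _ _ _ this, of k]
  have "segment_integral k 1 a b \<le> 4 * a powr - k * (?F 1 - ?F 0)
      + 2 powr (k + 1) / k * a powr - (k + 1)"
    using assms by simp
  also have "?F 1 - ?F 0 = ln ((b + a) / b) / a"
    using assms a by (simp add: ln_div diff_divide_distrib)
  also have "4 * a powr - k * (ln ((b + a) / b) / a) + 2 powr (k + 1) / k * a powr - (k + 1)
    \<le> 4 * a powr - k * (3 * m / a) + 2 powr (k + 1) / k * (a powr - (k + 1) * m)"
    using assms a ln_ratio_le[of b a]
    by (intro add_mono mult_left_mono divide_right_mono) (auto simp: m_def)
  also have "4 * a powr - k * (3 * m / a) = 12 * (a powr - (k + 1) * m)"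
    unfolding powr_minus_eq_mult[OF a, of k] using a by simp
  finally show ?thesis by (simp add: distrib_right m_def)
qed

text \<open>
  The layer \<open>u \<le> b / (2 a)\<close>, on which the denominator is at most a power of \<open>2 b\<close>, already carries the
  full power \<open>a\<^sup>-\<^sup>k\<^sup>-\<^sup>1 b\<^sup>1\<^sup>-\<^sup>h\<close>.
\<close>
lemma segment_integral_far_lower:
  assumes "0 < k" "1 \<le> h" "0 < b" "b \<le> a"
  shows "2 powr - (3 * k + h + 1) / (k + 1) * (a powr - (k + 1) * b powr (1 - h))
    \<le> segment_integral k h a b"
proof -
  have a: "0 < a" using assms by linarith
  define c where "c = b / (2 * a)"
  have c: "0 \<le> c" "c \<le> 1/2" using assms a by (auto simp: c_def field_simps)
  have "2 powr - k * (2 * b) powr - (k + h) * (c powr (k + 1) / (k + 1))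
    \<le> segment_integral k h a b"
  proof (rule segment_integral_ge[OF _ _ _ _
      has_integral_mult_right[OF has_integral_powr_from_0]])
    fix u assume u: "0 \<le> u" "u \<le> c"
    let ?D = "u * a + (1 - u) * b"
    have "u * a \<le> c * a" using u a by (intro mult_right_mono) auto
    also have "\<dots> = b / 2" using a by (simp add: c_def)
    finally have D: "?D \<le> 2 * b"
      using segment_bounds(4)[of a b u] assms a u c by linarith
    have "(2 * b) powr - (k + h) \<le> ?D powr - (k + h)"
      using D assms a segment_bounds(2)[of a b u] u c by (intro powr_mono2') auto
    moreover have "2 powr - k \<le> (1 - u) powr (k - 1)"
      using one_minus_powr_bounds(1)[of k u] assms u c by auto
    ultimately have "u powr k * 2 powr - k * (2 * b) powr - (k + h)
      \<le> segment_integrand k h a b u"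
      unfolding segment_integrand_def by (intro mult_mono) auto
    then show "2 powr - k * (2 * b) powr - (k + h) * u powr k
      \<le> segment_integrand k h a b u"
      by (simp add: mult_ac)
  qed (use assms a c in auto)
  moreover have "2 powr - k * (2 * b) powr - (k + h) * (c powr (k + 1) / (k + 1))
      = 2 powr - (3 * k + h + 1) / (k + 1) * (a powr - (k + 1) * b powr (1 - h))"
  proof -
    have e: "c powr (k + 1) = b powr (k + 1) * 2 powr - (k + 1) * a powr - (k + 1)"
      using assms a
      by (simp add: c_def powr_divide powr_mult powr_minus_divide del: minus_add_distrib)
    have e2: "(2 * b) powr - (k + h) = 2 powr - (k + h) * b powr - (k + h)"
      using assms by (simp add: powr_mult)
    have e3: "2 powr - (3 * k + h + 1) = 2 powr - k * 2 powr - (k + h) * (2 powr - (k + 1) :: real)"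
      by (simp only: powr_add[symmetric]) (simp add: algebra_simps)
    have e4: "b powr - (k + h) * b powr (k + 1) = b powr (1 - h)"
      by (simp add: powr_add[symmetric])
    have "2 powr - k * (2 * b) powr - (k + h) * (c powr (k + 1) / (k + 1))
      = (2 powr - k * 2 powr - (k + h) * 2 powr - (k + 1)) / (k + 1)
        * (a powr - (k + 1) * (b powr - (k + h) * b powr (k + 1)))"
      unfolding e e2 by (simp add: mult_ac del: minus_add_distrib)
    then show ?thesis unfolding e3 e4 .
  qed
  ultimately show ?thesis by (simp only:)
qed

text \<open>
  A logarithm above \<open>1\<close> comes from \<open>b / a \<le> u \<le> 1 / 2\<close>, where the denominator is comparable to
  \<open>(u a)\<^sup>k\<^sup>+\<^sup>1\<close> and the integrand to \<open>a\<^sup>-\<^sup>k\<^sup>-\<^sup>1 / u\<close>.  Otherwise the layer near \<open>0\<close> suffices.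
\<close>
lemma segment_integral_far_lower_log:
  assumes "0 < k" "0 < b" "b \<le> a"
  shows "2 powr - (3 * k + 2) / (k + 1) * (a powr - (k + 1) * max 1 (ln ((a - b) / 4 / b)))
    \<le> segment_integral k 1 a b"
proof -
  have a: "0 < a" using assms by linarith
  define m where "m = ln ((a - b) / 4 / b)"
  have c: "2 powr - (3 * k + 2) / (k + 1) \<le> 2 powr - (3 * k + 2)"
    using assms by (simp add: field_simps del: minus_add_distrib)
  show ?thesis
  proof (cases "m \<le> 1")
    case True
    then show ?thesis using segment_integral_far_lower[of k 1 b a] assms by (simp add: m_def algebra_simps)
  next
    case False
    have ab: "b < a" using False assms by (cases "a = b") (auto simp: m_def)
    have "exp 1 \<le> (a - b) / 4 / b"
      using False ab assms by (simp add: m_def ln_ge_iff[symmetric])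
    then have "1 \<le> (a - b) / 4 / b" using exp_ge_add_one_self[of 1] by linarith
    then have ab2: "4 * b \<le> a - b" using assms by (simp add: field_simps)
    have int: "((\<lambda>u. inverse u) has_integral ln (1 / 2) - ln (b / a)) {b / a..1 / 2}"
    proof (rule fundamental_theorem_of_calculus)
      fix u :: real assume "u \<in> {b / a..1 / 2}"
      then have "0 < u" using a assms by (auto intro: less_le_trans[of _ "b / a"])
      then show "(ln has_vector_derivative inverse u) (at u within {b / a..1 / 2})"
        by (auto intro!: derivative_eq_intros
            simp: has_real_derivative_iff_has_vector_derivative[symmetric] field_simps)
    qed (use ab2 assms a in \<open>auto simp: field_simps\<close>)
    have "2 powr - (2 * k + 1) * a powr - (k + 1) * (ln (1 / 2) - ln (b / a))
      \<le> segment_integral k 1 a b"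
    proof (rule segment_integral_ge[OF _ _ _ _ has_integral_mult_right[OF int]])
      fix u assume u: "b / a \<le> u" "u \<le> 1 / 2"
      have u0: "0 < u" using u assms a by (auto intro: less_le_trans[of _ "b / a"])
      let ?D = "u * a + (1 - u) * b"
      have "b \<le> u * a" using u a by (simp add: field_simps)
      then have D: "?D \<le> 2 * u * a"
        using segment_bounds(4)[of a b u] assms a u u0 by linarith
      have "(2 * u * a) powr - (k + 1) \<le> ?D powr - (k + 1)"
        using D assms a segment_bounds(2)[of a b u] u u0 by (intro powr_mono2') auto
      moreover have "2 powr - k \<le> (1 - u) powr (k - 1)"
        using one_minus_powr_bounds(1)[of k u] assms u u0 by auto
      ultimately have "u powr k * 2 powr - k * (2 * u * a) powr - (k + 1)
        \<le> segment_integrand k 1 a b u"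
        unfolding segment_integrand_def by (intro mult_mono) auto
      moreover have "u powr k * 2 powr - k * (2 * u * a) powr - (k + 1)
        = 2 powr - (2 * k + 1) * a powr - (k + 1) * inverse u"
      proof -
        have e: "(2 * u * a) powr - (k + 1) = 2 powr - (k + 1) * u powr - (k + 1) * a powr - (k + 1)"
          using u0 a by (simp add: powr_mult)
        have e2: "u powr k * u powr - (k + 1) = inverse u"
          using u0 by (simp add: powr_add[symmetric] powr_minus)
        have e3: "2 powr - (2 * k + 1) = 2 powr - k * (2 powr - (k + 1) :: real)"
          by (simp add: powr_add[symmetric])
        show ?thesis unfolding e e3 e2[symmetric] by (simp add: mult_ac)
      qed
      ultimately show "2 powr - (2 * k + 1) * a powr - (k + 1) * inverse u
        \<le> segment_integrand k 1 a b u" by simp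
    qed (use assms a in auto)
    moreover have "m \<le> ln (1 / 2) - ln (b / a)"
    proof -
      have "m \<le> ln (a / (2 * b))" unfolding m_def
        using ab assms by (subst ln_le_cancel_iff) (auto simp: field_simps)
      also have "\<dots> = ln (1 / 2) - ln (b / a)"
        using a assms by (simp add: ln_div ln_mult)
      finally show ?thesis .
    qed
    moreover have "2 powr - (3 * k + 2) / (k + 1) \<le> 2 powr - (2 * k + 1)"
      using c assms by (rule_tac order_trans[OF c]) (auto intro!: powr_mono)
    ultimately have "2 powr - (3 * k + 2) / (k + 1) * a powr - (k + 1) * m
      \<le> segment_integral k 1 a b"
      using False by (elim order_trans[rotated], intro mult_mono) auto
    then show ?thesis using False by (simp add: m_def mult_ac)
  qed
qed

section \<open>Two-sided estimates\<close>

lemma comparableI_two_constants: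
  assumes "0 < c" "0 \<le> T" "c * T \<le> J" "J \<le> C * T"
  shows "comparable (max C (inverse c)) J T"
proof -
  have "inverse (max C (inverse c)) \<le> inverse (inverse c)"
    using assms by (intro le_imp_inverse_le) auto
  then have "inverse (max C (inverse c)) * T \<le> c * T"
    using assms by (intro mult_right_mono) auto
  moreover have "C * T \<le> max C (inverse c) * T"
    using assms by (intro mult_right_mono) auto
  ultimately show ?thesis using assms unfolding comparable_def by linarith
qed

lemma comparable_mono:
  assumes "comparable C J T" "0 < C" "C \<le> C'" "0 \<le> T"
  shows "comparable C' J T"
proof -
  have "inverse C' * T \<le> inverse C * T" "C * T \<le> C' * T"
    using assms by (auto intro!: mult_right_mono)
  then show ?thesis using assms(1) unfolding comparable_def by linarith
qed

lemma comparable_scale: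
  assumes "comparable C J T" "0 < C" "0 < K" "0 \<le> w" "0 \<le> T"
  shows "comparable (C * max K (inverse K)) (K * w * J) (w * T)"
proof -
  define M where "M = max K (inverse K)"
  have M: "K \<le> M" "inverse M \<le> K" "0 < M"
    using assms le_imp_inverse_le[of "inverse K" M] by (auto simp: M_def)
  have J: "inverse C * T \<le> J" "J \<le> C * T" using assms by (auto simp: comparable_def)
  have J0: "0 \<le> J" using J(1) assms by (meson less_imp_le mult_nonneg_nonneg order_trans positive_imp_inverse_positive)
  have "inverse M * w * (inverse C * T) \<le> K * w * J"
    using assms M J by (intro mult_mono) auto
  moreover have "K * w * J \<le> M * w * (C * T)"
    using assms M J J0 by (intro mult_mono) auto
  ultimately show ?thesis
    unfolding comparable_def M_def[symmetric] by (simp add: mult_ac)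
qed

lemma segment_integral_comparable:
  assumes "0 < k" "1 < h"
  shows "\<exists>C>0. \<forall>a>0. \<forall>b>0. comparable C (segment_integral k h a b)
    (1 / (max a b powr k * a * min a b powr (h - 1)))"
proof -
  define C1 where "C1 = max (1 / k) (inverse (2 powr - (3 * k + h) / k))"
  define C2 where "C2 = max (2 * 2 powr h / (h - 1) + 2 powr (k + h) / k)
    (inverse (2 powr - (3 * k + h + 1) / (k + 1)))"
  have C: "0 < C1" "0 < C2" using assms by (auto simp: C1_def C2_def less_max_iff_disj)
  have "comparable (max C1 C2) (segment_integral k h a b)
    (1 / (max a b powr k * a * min a b powr (h - 1)))" if "0 < a" "0 < b" for a b
  proof (cases "a \<le> b")
    case True
    have "1 / (max a b powr k * a * min a b powr (h - 1)) = a powr - h * b powr - k"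
      using True that by (simp add: powr_diff powr_minus field_simps)
    moreover have "comparable C1 (segment_integral k h a b) (a powr - h * b powr - k)"
      unfolding C1_def
      by (rule comparableI_two_constants[OF _ _ segment_integral_near_lower segment_integral_near_upper])
         (use assms that True in simp_all)
    ultimately show ?thesis
      using comparable_mono[of C1 _ _ "max C1 C2"] C by simp
  next
    case False
    have "1 / (max a b powr k * a * min a b powr (h - 1)) = a powr - (k + 1) * b powr (1 - h)"
      using False that by (simp add: powr_diff powr_minus powr_add field_simps)
    moreover have "comparable C2 (segment_integral k h a b) (a powr - (k + 1) * b powr (1 - h))"
      unfolding C2_def
      by (rule comparableI_two_constants[OF _ _ segment_integral_far_lower segment_integral_far_upper])
         (use assms that False in simp_all)
    ultimately show ?thesis
      using comparable_mono[of C2 _ _ "max C1 C2"] C by simp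
  qed
  moreover have "0 < max C1 C2" using C by (simp add: less_max_iff_disj)
  ultimately show ?thesis by blast
qed

lemma segment_integral_comparable_log:
  assumes "0 < k"
  shows "\<exists>C>0. \<forall>a>0. \<forall>b>0. comparable C (segment_integral k 1 a b)
    (1 / (max a b powr k * a) * max 1 (ln (\<bar>b - a\<bar> / 4 / b)))"
proof -
  define C1 where "C1 = max (1 / k) (inverse (2 powr - (3 * k + 1) / k))"
  define C2 where "C2 = max (12 + 2 powr (k + 1) / k)
    (inverse (2 powr - (3 * k + 2) / (k + 1)))"
  have C: "0 < C1" "0 < C2" using assms by (auto simp: C1_def C2_def less_max_iff_disj)
  have "comparable (max C1 C2) (segment_integral k 1 a b)
    (1 / (max a b powr k * a) * max 1 (ln (\<bar>b - a\<bar> / 4 / b)))" if "0 < a" "0 < b" for a b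
  proof (cases "a \<le> b")
    case True
    have "ln (\<bar>b - a\<bar> / 4 / b) \<le> 1"
    proof (cases "a = b")
      case False
      then have "ln (\<bar>b - a\<bar> / 4 / b) \<le> ln 1"
        using True that by (subst ln_le_cancel_iff) (auto simp: field_simps)
      then show ?thesis by simp
    qed simp
    then have "1 / (max a b powr k * a) * max 1 (ln (\<bar>b - a\<bar> / 4 / b))
      = a powr - 1 * b powr - k"
      using True that by (simp add: powr_minus field_simps)
    moreover have "comparable C1 (segment_integral k 1 a b) (a powr - 1 * b powr - k)"
      unfolding C1_def
      by (rule comparableI_two_constants[OF _ _ segment_integral_near_lower segment_integral_near_upper])
         (use assms that True in simp_all)
    ultimately show ?thesis
      using comparable_mono[of C1 _ _ "max C1 C2"] C by simp
  next
    case False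
    let ?m = "max 1 (ln ((a - b) / 4 / b))"
    have "1 / (max a b powr k * a) * max 1 (ln (\<bar>b - a\<bar> / 4 / b)) = a powr - (k + 1) * ?m"
      using False that by (simp add: powr_minus_divide powr_add del: minus_add_distrib)
    moreover have "comparable C2 (segment_integral k 1 a b) (a powr - (k + 1) * ?m)"
      unfolding C2_def
      by (rule comparableI_two_constants[OF _ _ segment_integral_far_lower_log segment_integral_far_upper_log])
         (use assms that False in simp_all)
    moreover have "0 \<le> a powr - (k + 1) * ?m" by simp
    ultimately show ?thesis
      using comparable_mono[of C2 _ _ "max C1 C2"] C by simp
  qed
  moreover have "0 < max C1 C2" using C by (simp add: less_max_iff_disj)
  ultimately show ?thesis by blast
qed

section \<open>From the Poisson kernel to the one-variable integral\<close>

lemma norm_diff_sq_split: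
  fixes x y :: "real ^ 'n::finite" and i :: 'n
  shows "(norm (x - y))\<^sup>2 = (norm x)\<^sup>2 + (norm y)\<^sup>2
      - 2 * (x $ i * y $ i + (\<Sum>j\<in>UNIV - {i}. x $ j * y $ j))"
    and "(norm (x - root_reflection i y))\<^sup>2 = (norm x)\<^sup>2 + (norm y)\<^sup>2
      - 2 * (- (x $ i * y $ i) + (\<Sum>j\<in>UNIV - {i}. x $ j * y $ j))"
proof -
  have inner: "x \<bullet> z = x $ i * z $ i + (\<Sum>j\<in>UNIV - {i}. x $ j * z $ j)" for x z :: "real ^ 'n"
    by (simp add: inner_vec_def sum.remove[of UNIV i])
  have sq: "(norm (x - z))\<^sup>2 = (norm x)\<^sup>2 + (norm z)\<^sup>2 - 2 * (x \<bullet> z)" for z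
    by (simp add: power2_norm_eq_inner inner_diff inner_commute)
  show "(norm (x - y))\<^sup>2 = (norm x)\<^sup>2 + (norm y)\<^sup>2
      - 2 * (x $ i * y $ i + (\<Sum>j\<in>UNIV - {i}. x $ j * y $ j))"
    by (simp add: sq inner)
  have "root_reflection i y \<bullet> root_reflection i y = y \<bullet> y"
    unfolding inner[of "root_reflection i y" "root_reflection i y"] inner[of y y]
    by (simp add: root_reflection_def)
  then have "(norm (root_reflection i y))\<^sup>2 = (norm y)\<^sup>2" by (simp add: power2_norm_eq_inner)
  then show "(norm (x - root_reflection i y))\<^sup>2 = (norm x)\<^sup>2 + (norm y)\<^sup>2
      - 2 * (- (x $ i * y $ i) + (\<Sum>j\<in>UNIV - {i}. x $ j * y $ j))"
    by (simp add: sq inner[of x] root_reflection_def)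
qed

lemma ball_sphere_dist_pos:
  fixes x y :: "real ^ 'n::finite"
  assumes "x \<in> ball 0 1" "y \<in> sphere 0 1"
  shows "0 < norm (x - y)" "0 < norm (x - root_reflection i y)"
proof -
  have "(norm (0 - root_reflection i y))\<^sup>2 = (norm (0 - y))\<^sup>2"
    using norm_diff_sq_split[where x = 0 and y = y and i = i] by simp
  then have "norm (root_reflection i y) = 1" using assms by simp
  then show "0 < norm (x - y)" "0 < norm (x - root_reflection i y)"
    using assms by auto
qed

text \<open>
  The substitution \<open>t = 2 u - 1\<close>: it contributes \<open>2\<^sup>k\<^sup>-\<^sup>1 2\<^sup>k\<close> from the weights and \<open>2\<close> from \<open>dt\<close>,
  hence the factor \<open>4\<^sup>k\<close>.
\<close>
lemma dunkl_poisson_kernel_eq_segment_integral: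
  fixes x y :: "real ^ 'n::finite"
  assumes "0 < k" "x \<in> ball 0 1" "y \<in> sphere 0 1"
  shows "dunkl_poisson_kernel k i x y = dunkl_const k * 4 powr k * (1 - (norm x)\<^sup>2)
    * segment_integral k (real CARD('n) / 2)
        ((norm (x - y))\<^sup>2) ((norm (x - root_reflection i y))\<^sup>2)"
proof -
  define a where "a = (norm (x - y))\<^sup>2"
  define b where "b = (norm (x - root_reflection i y))\<^sup>2"
  define h where "h = real CARD('n) / 2"
  define w where "w = 1 - (norm x)\<^sup>2"
  define S where "S = (\<Sum>j\<in>UNIV - {i}. x $ j * y $ j)"
  have pos: "0 < a" "0 < b" using ball_sphere_dist_pos[OF assms(2,3)] by (auto simp: a_def b_def)
  have ab: "a = (norm x)\<^sup>2 + 1 - 2 * (x $ i * y $ i + S)"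
    "b = (norm x)\<^sup>2 + 1 - 2 * (- (x $ i * y $ i) + S)"
    using norm_diff_sq_split[where x = x and y = y and i = i] assms by (auto simp: a_def b_def S_def)
  have "(segment_integrand k h a b has_integral segment_integral k h a b) (cbox 0 1)"
    unfolding segment_integral_def cbox_interval
    using assms pos by (intro integrable_integral segment_integrand_integrable) (auto simp: h_def)
  from has_integral_affinity'[OF this, of "1/2" "1/2"]
  have "((\<lambda>t. segment_integrand k h a b (t / 2 + 1 / 2))
      has_integral 2 * segment_integral k h a b) {-1..1}"
    by simp
  from has_integral_mult_right[OF this, of "w * (4 powr k / 2)"]
  have "((\<lambda>t. w * (4 powr k / 2) * segment_integrand k h a b (t / 2 + 1 / 2))
      has_integral w * 4 powr k * segment_integral k h a b) {-1..1}"
    by (simp add: mult.assoc)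
  then have "((\<lambda>t. w * (1 - t) powr (k - 1) * (1 + t) powr k
      / ((norm x)\<^sup>2 + 1 - 2 * (t * (x $ i) * (y $ i) + S)) powr (k + h))
      has_integral w * 4 powr k * segment_integral k h a b) {-1..1}"
  proof (rule has_integral_eq[rotated])
    fix t :: real assume t: "t \<in> {-1..1}"
    define u where "u = t / 2 + 1 / 2"
    have u: "0 \<le> u" "u \<le> 1" and tu: "1 + t = 2 * u" "1 - t = 2 * (1 - u)" "t = 2 * u - 1"
      using t by (auto simp: u_def)
    have D: "(norm x)\<^sup>2 + 1 - 2 * (t * (x $ i) * (y $ i) + S) = u * a + (1 - u) * b"
      unfolding ab tu(3) by (simp add: algebra_simps)
    have c: "4 powr k / 2 = (2 powr (k - 1) * 2 powr k :: real)"
    proof -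
      have "(4::real) powr k = 2 powr k * 2 powr k" using powr_mult[of 2 2 k] by simp
      then show ?thesis by (simp add: powr_diff)
    qed
    have powr_mult_one_minus:
      "(2 * (1 - u)) powr (k - 1) = 2 powr (k - 1) * (1 - u) powr (k - 1)"
      by (rule powr_mult)
    show "w * (4 powr k / 2) * segment_integrand k h a b (t / 2 + 1 / 2)
      = w * (1 - t) powr (k - 1) * (1 + t) powr k
      / ((norm x)\<^sup>2 + 1 - 2 * (t * (x $ i) * (y $ i) + S)) powr (k + h)"
      unfolding D c u_def[symmetric] segment_integrand_def tu(1,2) powr_mult_one_minus
      using u by (simp add: powr_mult powr_minus_divide del: minus_add_distrib)
  qed
  then show ?thesis
    unfolding dunkl_poisson_kernel_def h_def[symmetric] w_def[symmetric] S_def[symmetric]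
      a_def[symmetric] b_def[symmetric]
    by (simp add: integral_unique mult_ac)
qed

lemma dunkl_const_pos: "0 < k \<Longrightarrow> 0 < dunkl_const k"
  by (simp add: dunkl_const_def Gamma_real_pos)

lemma sq_powr: "0 \<le> r \<Longrightarrow> (r\<^sup>2) powr p = r powr (2 * p)" for r :: real
  by (cases "r = 0") (simp_all add: powr_powr flip: powr_numeral)

theorem corollary5p7:
  fixes k :: real
  assumes "k > 0" and "CARD('n::finite) \<ge> 2"
  shows "(CARD('n) = 2 \<longrightarrow>
      (\<exists>C>0. \<forall>i::'n. \<forall>x\<in>ball 0 1. \<forall>y\<in>sphere 0 1.
        comparable C (dunkl_poisson_kernel k i x y)
          ((1 - (norm x)\<^sup>2) / (max_dist i x y powr (2 * k) * (norm (x - y))\<^sup>2)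
            * log_factor i x y)))
    \<and> (CARD('n) \<ge> 3 \<longrightarrow>
      (\<exists>C>0. \<forall>i::'n. \<forall>x\<in>ball 0 1. \<forall>y\<in>sphere 0 1.
        comparable C (dunkl_poisson_kernel k i x y)
          ((1 - (norm x)\<^sup>2) /
            (max_dist i x y powr (2 * k) * (norm (x - y))\<^sup>2
              * min_dist i x y ^ (CARD('n) - 2)))))"
proof -
  define K where "K = dunkl_const k * 4 powr k"
  have K: "0 < K" "0 < max K (inverse K)"
    using dunkl_const_pos assms by (auto simp: K_def less_max_iff_disj)
  define h where "h = real CARD('n) / 2"
  have max_sq: "max (r\<^sup>2) (s\<^sup>2) = (max r s)\<^sup>2" and min_sq: "min (r\<^sup>2) (s\<^sup>2) = (min r s)\<^sup>2"
    if "0 \<le> r" "0 \<le> s" for r s :: real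
    using that by (auto simp: max_def min_def)
  \<comment> \<open>Any uniform bound of the one-variable integral by \<open>T\<close> yields the bound of the kernel by
    \<open>1 - |x|\<^sup>2\<close> times \<open>T\<close>, with a constant that depends on \<open>k\<close> and the dimension only.\<close>
  have transfer: "\<exists>C>0. \<forall>i::'n. \<forall>x\<in>ball 0 1. \<forall>y\<in>sphere 0 1.
      comparable C (dunkl_poisson_kernel k i x y) (B i x y)"
    if bound: "\<exists>C>0. \<forall>a>0. \<forall>b>0. comparable C (segment_integral k h a b) (T a b)"
      and T: "\<And>a b. 0 < a \<Longrightarrow> 0 < b \<Longrightarrow> 0 \<le> T a b"
      and B: "\<And>i x y. x \<in> ball 0 1 \<Longrightarrow> y \<in> sphere 0 1 \<Longrightarrow> B i x y =
        (1 - (norm x)\<^sup>2) * T ((norm (x - y))\<^sup>2) ((norm (x - root_reflection i y))\<^sup>2)"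
    for B :: "'n \<Rightarrow> real ^ 'n \<Rightarrow> real ^ 'n \<Rightarrow> real" and T
  proof -
    obtain C where C: "0 < C"
      "\<And>a b. 0 < a \<Longrightarrow> 0 < b \<Longrightarrow> comparable C (segment_integral k h a b) (T a b)"
      using bound by blast
    have "comparable (C * max K (inverse K)) (dunkl_poisson_kernel k i x y) (B i x y)"
      if xy: "x \<in> ball 0 1" "y \<in> sphere 0 1" for i x y
    proof -
      have "(norm x)\<^sup>2 \<le> 1" using xy by (simp add: power_le_one)
      then show ?thesis
        unfolding B[OF xy] dunkl_poisson_kernel_eq_segment_integral[OF assms(1) xy]
          K_def[symmetric] h_def[symmetric]
        using ball_sphere_dist_pos[OF xy] K C T by (intro comparable_scale) auto
    qed
    then show ?thesis using C(1) K(2) by (intro exI[of _ "C * max K (inverse K)"]) auto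
  qed
  show ?thesis
  proof (intro conjI impI)
    assume "CARD('n) = 2"
    then have h: "h = 1" by (simp add: h_def)
    show "\<exists>C>0. \<forall>i::'n. \<forall>x\<in>ball 0 1. \<forall>y\<in>sphere 0 1.
        comparable C (dunkl_poisson_kernel k i x y)
          ((1 - (norm x)\<^sup>2) / (max_dist i x y powr (2 * k) * (norm (x - y))\<^sup>2)
            * log_factor i x y)"
    proof (rule transfer[unfolded h, OF segment_integral_comparable_log[OF assms(1)]])
      fix i :: 'n and x y :: "real ^ 'n"
      assume "x \<in> ball 0 1" "y \<in> sphere 0 1"
      have "(norm (x - root_reflection i y))\<^sup>2 - (norm (x - y))\<^sup>2 = 4 * (x $ i * y $ i)"
        using norm_diff_sq_split[where x = x and y = y and i = i] by simp
      then have "\<bar>(norm (x - root_reflection i y))\<^sup>2 - (norm (x - y))\<^sup>2\<bar> / 4 = \<bar>x $ i * y $ i\<bar>"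
        by (simp add: abs_mult)
      then show "(1 - (norm x)\<^sup>2) / (max_dist i x y powr (2 * k) * (norm (x - y))\<^sup>2)
            * log_factor i x y =
        (1 - (norm x)\<^sup>2) * (1 / (max ((norm (x - y))\<^sup>2) ((norm (x - root_reflection i y))\<^sup>2)
            powr k * (norm (x - y))\<^sup>2)
          * max 1 (ln (\<bar>(norm (x - root_reflection i y))\<^sup>2 - (norm (x - y))\<^sup>2\<bar> / 4
            / (norm (x - root_reflection i y))\<^sup>2)))"
        by (simp add: max_sq sq_powr max_dist_def log_factor_def le_max_iff_disj)
    qed auto
  next
    assume card: "3 \<le> CARD('n)"
    then have h: "1 < h" by (simp add: h_def)
    show "\<exists>C>0. \<forall>i::'n. \<forall>x\<in>ball 0 1. \<forall>y\<in>sphere 0 1.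
        comparable C (dunkl_poisson_kernel k i x y)
          ((1 - (norm x)\<^sup>2) /
            (max_dist i x y powr (2 * k) * (norm (x - y))\<^sup>2
              * min_dist i x y ^ (CARD('n) - 2)))"
    proof (rule transfer[OF segment_integral_comparable[OF assms(1) h]])
      fix i :: 'n and x y :: "real ^ 'n"
      assume xy: "x \<in> ball 0 1" "y \<in> sphere 0 1"
      have "2 * (h - 1) = real (CARD('n) - 2)" using card by (simp add: h_def of_nat_diff)
      then have "(min_dist i x y)\<^sup>2 powr (h - 1) = min_dist i x y ^ (CARD('n) - 2)"
        using ball_sphere_dist_pos[OF xy]
        by (simp add: sq_powr powr_realpow min_dist_def)
      then show "(1 - (norm x)\<^sup>2) /
            (max_dist i x y powr (2 * k) * (norm (x - y))\<^sup>2
              * min_dist i x y ^ (CARD('n) - 2)) =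
        (1 - (norm x)\<^sup>2) * (1 / (max ((norm (x - y))\<^sup>2) ((norm (x - root_reflection i y))\<^sup>2)
            powr k * (norm (x - y))\<^sup>2
          * min ((norm (x - y))\<^sup>2) ((norm (x - root_reflection i y))\<^sup>2) powr (h - 1)))"
        by (simp add: max_sq min_sq sq_powr max_dist_def min_dist_def le_max_iff_disj)
    qed auto
  qed
qed

end
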